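(* Let $p$ be a prime and let $[w]$ be a necklace of length $n$ over $\Sigma_p$. The following are equivalent: (1) $[w]$ is invertible, i.e. its Burrows–Wheeler matrix is nonsingular over $\mathrm{GF}_p$; (2) every word in $[w]$ has an invertible circulant matrix over $\mathrm{GF}_p$; (3) the set $\mathrm{CM}_{[w]}=\{\mathrm{CM}_v: v\in[w]\}$ is an element of the Reutenauer group $RG_p^n$; (4) for every word $v=v_0\cdots v_{n-1}\in[w]$, the element $\sum_{j=0}^{n-1}v_j\gamma^{p^j}$ of $\mathrm{GF}_{p^n}$ is normal, where $\gamma$ is a fixed normal element of $\mathrm{GF}_{p^n}$; (5) every word $x$ of length $n$ over $\Sigma_p$ can be written in a unique way as $x=\sum_{v\in[w]}c_v v \pmod p$ (componentwise) with $c_v\in\{0,\ldots,p-1\}$.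
   Context: $\Sigma_p=\{0,\ldots,p-1\}$, identified with $\mathrm{GF}_p$; words of length $n$ are identified with vectors in $\mathrm{GF}_p^n$. The shift of $w=w_0\cdots w_{n-1}$ is $\sigma(w)=w_{n-1}w_0\cdots w_{n-2}$, and the necklace $[w]$ is the set of rotations of $w$. The Burrows–Wheeler matrix of $[w]$ is the $n\times n$ matrix whose rows are the $n$ rotations $\sigma^i(w)$, $0\le i<n$ (with multiplicity), in ascending lexicographic order. The circulant matrix $\mathrm{CM}_v$ of a word $v$ of length $n$ is the $n\times n$ matrix whose $(i+1)$-th row is $\sigma^i(v)$, $0\le i<n$. $C(p,n)$ is the group (under matrix multiplication) of invertible $n\times n$ circulant matrices over $\mathrm{GF}_p$, $Q_n$ is the permutation matrix of the cycle $(0\ 1\ \cdots\ n-1)$, and the Reutenauer group is $RG_p^n=C(p,n)/\langle Q_n\rangle$, whose elements are cosets of $\langle Q_n\rangle$. An element $\gamma\in\mathrm{GF}_{p^n}$ is normal if $\{\gamma,\gamma^p,\ldots,\gamma^{p^{n-1}}\}$ is a basis of $\mathrm{GF}_{p^n}$ over $\mathrm{GF}_p$. *)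

theory Defs
  imports
    "HOL-Library.FuncSet"
    "HOL-Library.List_Lexorder"
    "HOL-Algebra.Coset"
    "HOL-Algebra.Generated_Groups"
    "Jordan_Normal_Form.Matrix"
    "Jordan_Normal_Form.Determinant"
    "Berlekamp_Zassenhaus.Finite_Field"
begin

text \<open>
  The type \<^typ>\<open>'p::prime_card mod_ring\<close> is the field with \<open>CARD('p)\<close> elements, represented by the
  integers \<open>0, \<dots>, CARD('p) - 1\<close>. It serves both as the alphabet and as the prime field, so words
  of length \<open>n\<close> are lists of length \<open>n\<close> over it.
\<close>

subsection \<open>Words, necklaces and their matrices\<close>

text \<open>This is the rotation to the right, the inverse of the library's \<^const>\<open>rotate1\<close>.\<close>

definition shift :: "'a list \<Rightarrow> 'a list" where
  "shift w = (if w = [] then [] else last w # butlast w)"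

definition rotations :: "'a list \<Rightarrow> 'a list list" where
  "rotations w = map (\<lambda>i. (shift ^^ i) w) [0..<length w]"

definition necklace :: "'a list \<Rightarrow> 'a list set" where
  "necklace w = set (rotations w)"

definition circulant_mat :: "'a list \<Rightarrow> 'a mat" where
  "circulant_mat v = mat_of_rows_list (length v) (rotations v)"

text \<open>
  The letters are ordered as integers \<open>0 < 1 < \<dots> < p - 1\<close>; the order on \<^typ>\<open>int list\<close>
  is the lexicographic one of \<^theory>\<open>HOL-Library.List_Lexorder\<close>.
\<close>

definition bw_mat :: "'p::prime_card mod_ring list \<Rightarrow> 'p mod_ring mat" where
  "bw_mat w = mat_of_rows_list (length w) (sort_key (map to_int_mod_ring) (rotations w))"

definition invertible_necklace :: "'p::prime_card mod_ring list \<Rightarrow> bool" where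
  "invertible_necklace w \<longleftrightarrow> det (bw_mat w) \<noteq> 0"

subsection \<open>The Reutenauer group\<close>

definition circulant_group :: "nat \<Rightarrow> 'a::field mat monoid" where
  "circulant_group n =
    \<lparr>carrier = {circulant_mat v | v. length v = n \<and> invertible_mat (circulant_mat v)},
     mult = (*), one = 1\<^sub>m n\<rparr>"

text \<open>
  Row \<open>i\<close> has its entry \<open>1\<close> in column \<open>i + 1\<close> modulo \<open>n\<close>. The transposed convention for
  permutation matrices gives the inverse matrix, hence the same generated subgroup.
\<close>

definition cycle_mat :: "nat \<Rightarrow> 'a::field mat" where
  "cycle_mat n = mat n n (\<lambda>(i, j). if j = (i + 1) mod n then 1 else 0)"

definition reutenauer_group :: "nat \<Rightarrow> 'a::field mat set monoid" where
  "reutenauer_group n =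
    circulant_group n Mod generate (circulant_group n) {cycle_mat n}"

subsection \<open>Normal elements\<close>

text \<open>
  The type \<^typ>\<open>'k\<close> is meant to be a field of characteristic \<open>CARD('p)\<close>. Then the following
  is the unique ring homomorphism from the prime field, and \<open>gf_scale\<close> is the induced
  vector space structure. The field with \<open>p ^ n\<close> elements is a field type \<^typ>\<open>'k\<close>
  with \<open>CARD('k) = p ^ n\<close>.
\<close>

definition gf_embed :: "'p::prime_card mod_ring \<Rightarrow> 'k::field" where
  "gf_embed c = of_int (to_int_mod_ring c)"

definition gf_scale :: "'p::prime_card mod_ring \<Rightarrow> 'k::field \<Rightarrow> 'k" where
  "gf_scale c x = gf_embed c * x"

definition normal_element :: "'p::prime_card itself \<Rightarrow> nat \<Rightarrow> 'k::field \<Rightarrow> bool" where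
  "normal_element P n \<gamma> \<longleftrightarrow>
    (let B = (\<lambda>j. \<gamma> ^ (CARD('p) ^ j)) ` {..<n};
         scale = (gf_scale :: 'p mod_ring \<Rightarrow> 'k \<Rightarrow> 'k)
     in \<not> module.dependent scale B \<and> module.span scale B = UNIV)"

end

theory Submission
  imports Defs "HOL-Number_Theory.Residues"
begin

text \<open>
  All conditions say that the rows of the circulant matrix of \<open>w\<close> span the space of words. The
  Burrows--Wheeler matrix has the same rows in another order. Shifting a word multiplies its
  circulant matrix from the left by the cycle matrix \<open>Q\<close>, so \<open>CM[w]\<close> is the coset
  of \<open>CM\<^sub>w\<close> modulo the powers of \<open>Q\<close>. Finally, the Frobenius map sends
  \<open>\<Sum>j. v ! j * \<gamma> ^ (p ^ j)\<close> to the corresponding sum for the shift of \<open>v\<close>, so the conjugates of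
  this element have the rows of \<open>CM\<^sub>v\<close> as coordinates in the normal basis of \<open>\<gamma>\<close>.
\<close>

section \<open>Rows of a nonsingular matrix\<close>

lemma invertible_mat_iff_det_nonzero:
  fixes A :: "'a::field mat"
  assumes A: "A \<in> carrier_mat n n"
  shows "invertible_mat A \<longleftrightarrow> det A \<noteq> 0"
proof
  assume "invertible_mat A"
  then obtain B where AB: "A * B = 1\<^sub>m n" and BA: "B * A = 1\<^sub>m (dim_row B)"
    using A by (auto simp: invertible_mat_def inverts_mat_def)
  \<comment> \<open>\<open>inverts_mat\<close> leaves the format of \<open>B\<close> open; comparing
    the columns of both products shows that \<open>B\<close> is square of size
    \<open>n\<close>.\<close>
  have "dim_row B = n" "dim_col B = n"
    using A arg_cong[OF AB, of dim_col] arg_cong[OF BA, of dim_col] by auto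
  then have "B \<in> carrier_mat n n" by auto
  from det_mult[OF A this] AB show "det A \<noteq> 0" by auto
next
  assume "det A \<noteq> 0"
  from det_non_zero_imp_unit[OF A this, of "()"] obtain B
    where "B \<in> carrier_mat n n" "B * A = 1\<^sub>m n" "A * B = 1\<^sub>m n"
    by (auto simp: Units_def ring_mat_def)
  then show "invertible_mat A"
    using A by (auto simp: invertible_mat_def inverts_mat_def)
qed

lemma index_mult_mat_sum:
  assumes "A \<in> carrier_mat m n" "B \<in> carrier_mat n k" "i < m" "j < k"
  shows "(A * B) $$ (i, j) = (\<Sum>l<n. A $$ (i, l) * B $$ (l, j))"
  using assms by (auto simp: scalar_prod_def atLeast0LessThan)

text \<open>A combination of rows is a row vector times \<open>A\<close>, so the coefficients are
  \<open>x\<close> times the inverse of \<open>A\<close>.\<close>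

lemma det_nonzero_imp_row_combination:
  fixes A :: "'a::field mat"
  assumes A: "A \<in> carrier_mat n n" and "det A \<noteq> 0"
  shows "\<exists>c. \<forall>j<n. x j = (\<Sum>i<n. c i * A $$ (i, j))"
proof -
  from det_non_zero_imp_unit[OF assms, of "()"] obtain B
    where B: "B \<in> carrier_mat n n" and BA: "B * A = 1\<^sub>m n"
    by (auto simp: Units_def ring_mat_def)
  define C where "C = mat 1 n (\<lambda>(i, j). x j)"
  have C: "C \<in> carrier_mat 1 n" by (simp add: C_def)
  have CB: "C * B \<in> carrier_mat 1 n" using B C by simp
  have "C * B * A = C * (B * A)" by (rule assoc_mult_mat[OF C B A])
  then have "C * B * A = C" using C BA by simp
  then have "x j = (\<Sum>i<n. (C * B) $$ (0, i) * A $$ (i, j))" if "j < n" for j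
    using index_mult_mat_sum[OF CB A, of 0 j] that by (simp add: C_def)
  then show ?thesis by (intro exI[of _ "\<lambda>i. (C * B) $$ (0, i)"] allI impI)
qed

text \<open>Multiplying the combination from the right by the inverse of \<open>A\<close> recovers
  the coefficient row.\<close>

lemma det_nonzero_row_combination_unique:
  fixes A :: "'a::field mat"
  assumes A: "A \<in> carrier_mat n n" and "det A \<noteq> 0"
    and eq: "\<And>j. j < n \<Longrightarrow> (\<Sum>i<n. c i * A $$ (i, j)) = (\<Sum>i<n. d i * A $$ (i, j))"
    and "i < n"
  shows "c i = d i"
proof -
  from det_non_zero_imp_unit[OF assms(1,2), of "()"] obtain B
    where B: "B \<in> carrier_mat n n" and AB: "A * B = 1\<^sub>m n"
    by (auto simp: Units_def ring_mat_def)
  define M where "M u = mat 1 n (\<lambda>(i, j). u j)" for u :: "nat \<Rightarrow> 'a"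
  have M: "M u \<in> carrier_mat 1 n" for u by (simp add: M_def)
  have recover: "M u * A * B = M u" for u
    using assoc_mult_mat[OF M A B] AB right_mult_one_mat[OF M] by simp
  have "M c * A = M d * A"
  proof (rule eq_matI)
    fix k j assume "k < dim_row (M d * A)" "j < dim_col (M d * A)"
    then have "k = 0" "j < n" using M A by (auto simp: M_def)
    then show "(M c * A) $$ (k, j) = (M d * A) $$ (k, j)"
      using eq index_mult_mat_sum[OF M A, of 0 j] by (simp add: M_def)
  qed (simp_all add: M_def)
  then have "M c = M d" using recover by metis
  then have "M c $$ (0, i) = M d $$ (0, i)" by simp
  then show ?thesis using \<open>i < n\<close> by (simp add: M_def)
qed

text \<open>Applied to the unit vectors, the hypothesis yields coefficient vectors that are the rows
  of a left inverse of \<open>A\<close>.\<close>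

lemma row_combinations_imp_det_nonzero:
  fixes A :: "'a::field mat"
  assumes A: "A \<in> carrier_mat n n"
    and comb: "\<And>x. \<exists>c. \<forall>j<n. x j = (\<Sum>i<n. c i * A $$ (i, j))"
  shows "det A \<noteq> 0"
proof -
  have "\<forall>k. \<exists>c. \<forall>j<n. (if k = j then 1 else 0) = (\<Sum>i<n. c i * A $$ (i, j))"
    by (intro allI comb)
  from choice[OF this] obtain c where
    c: "\<And>k j. j < n \<Longrightarrow> (\<Sum>i<n. c k i * A $$ (i, j)) = (if k = j then 1 else 0)"
    by auto
  define B where "B = mat n n (\<lambda>(k, i). c k i)"
  have B: "B \<in> carrier_mat n n" by (simp add: B_def)
  have "B * A = 1\<^sub>m n"
  proof (rule eq_matI)
    fix k j assume "k < dim_row (1\<^sub>m n :: 'a mat)" "j < dim_col (1\<^sub>m n :: 'a mat)"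
    then show "(B * A) $$ (k, j) = 1\<^sub>m n $$ (k, j)"
      using c index_mult_mat_sum[OF B A, of k j] by (simp add: B_def)
  qed (use A B in auto)
  with det_mult[OF B A] show ?thesis by auto
qed

text \<open>Lists with the same multiset differ by a permutation, and permuting rows changes the
  determinant only by a sign, which is nonzero in every field.\<close>

lemma det_mat_of_rows_list_mset_cong:
  fixes xs ys :: "'a::field list list"
  assumes "mset xs = mset ys" and len: "length ys = n"
  shows "det (mat_of_rows_list n xs) = 0 \<longleftrightarrow> det (mat_of_rows_list n ys) = 0"
proof -
  from assms(1) obtain q where q: "q permutes {..<length ys}" and xs: "permute_list q ys = xs"
    by (rule mset_eq_permutation)
  have q': "q permutes {0..<n}" using q len by (simp add: atLeast0LessThan)
  have "mat_of_rows_list n xs = mat n n (\<lambda>(i, j). mat_of_rows_list n ys $$ (q i, j))"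
  proof (rule eq_matI)
    fix i j
    assume "i < dim_row (mat n n (\<lambda>(i, j). mat_of_rows_list n ys $$ (q i, j)))"
      and "j < dim_col (mat n n (\<lambda>(i, j). mat_of_rows_list n ys $$ (q i, j)))"
    then have ij: "i < n" "j < n" by auto
    then have "q i < n" using permutes_in_image[OF q'] by simp
    then show "mat_of_rows_list n xs $$ (i, j) =
        mat n n (\<lambda>(i, j). mat_of_rows_list n ys $$ (q i, j)) $$ (i, j)"
      using ij len q by (auto simp: mat_of_rows_list_def permute_list_nth simp flip: xs)
  qed (auto simp: mat_of_rows_list_def len simp flip: xs)
  moreover have "mat_of_rows_list n ys \<in> carrier_mat n n"
    by (simp add: mat_of_rows_list_def len)
  moreover have "(signof q :: 'a) \<noteq> 0" by (simp add: sign_def)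
  ultimately show ?thesis
    using det_permute_rows[OF _ q', of "mat_of_rows_list n ys"] by simp
qed

section \<open>Rotations and circulant matrices\<close>

lemma length_shift [simp]: "length (shift w) = length w"
  by (simp add: shift_def)

lemma length_funpow_shift [simp]: "length ((shift ^^ i) w) = length w"
  by (induction i) auto

text \<open>Naming the target position modulo the length treats the wrap-around of the last letter
  like all other letters.\<close>

lemma shift_nth:
  assumes "j < length w"
  shows "shift w ! (Suc j mod length w) = w ! j"
proof (cases "Suc j = length w")
  case True
  then show ?thesis
    by (cases w rule: rev_cases) (auto simp: shift_def)
next
  case False
  with assms have "Suc j mod length w = Suc j" by simp
  with assms False show ?thesis by (auto simp: shift_def nth_butlast)
qed

lemma funpow_shift_nth:
  assumes "j < length w"
  shows "(shift ^^ i) w ! ((j + i) mod length w) = w ! j"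
proof (induction i)
  case (Suc i)
  have "(j + i) mod length w < length ((shift ^^ i) w)"
    using assms by (cases w) auto
  from shift_nth[OF this] Suc show ?case by (simp add: mod_Suc_eq)
qed (use assms in simp)

lemma funpow_shift_length [simp]: "(shift ^^ length w) w = w"
proof (rule nth_equalityI)
  fix j assume "j < length ((shift ^^ length w) w)"
  then show "(shift ^^ length w) w ! j = w ! j"
    using funpow_shift_nth[of j w "length w"] by simp
qed simp

lemma funpow_shift_mod: "(shift ^^ (i mod length w)) w = (shift ^^ i) w"
  by (rule funpow_mod_eq) simp

text \<open>Rotation has period \<open>length w\<close>, so exponents need no bound. For the empty
  word the necklace is empty while the range is not.\<close>

lemma necklace_eq_range:
  assumes "w \<noteq> []"
  shows "necklace w = range (\<lambda>i. (shift ^^ i) w)"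
proof -
  have "(shift ^^ i) w \<in> necklace w" for i
    using assms by (auto simp: necklace_def rotations_def intro!: image_eqI[of _ _ "i mod length w"]
        simp: funpow_shift_mod)
  then show ?thesis by (auto simp: necklace_def rotations_def)
qed

lemma circulant_mat_carrier [simp]: "circulant_mat v \<in> carrier_mat (length v) (length v)"
  by (simp add: circulant_mat_def rotations_def mat_of_rows_list_def)

lemma circulant_mat_index:
  "i < length v \<Longrightarrow> j < length v \<Longrightarrow> circulant_mat v $$ (i, j) = (shift ^^ i) v ! j"
  by (simp add: circulant_mat_def rotations_def mat_of_rows_list_def)

text \<open>Left multiplication by the cycle matrix replaces row \<open>i\<close> by row
  \<open>i + 1\<close> modulo the length; for the last row this agrees with one more shift because
  rotation is periodic.\<close>

lemma circulant_mat_shift: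
  fixes v :: "'a::field list"
  shows "circulant_mat (shift v) = cycle_mat (length v) * circulant_mat v"
proof (rule eq_matI)
  let ?n = "length v"
  have Q: "cycle_mat ?n \<in> carrier_mat ?n ?n" by (simp add: cycle_mat_def)
  fix i j
  assume "i < dim_row (cycle_mat ?n * circulant_mat v)"
    "j < dim_col (cycle_mat ?n * circulant_mat v)"
  then have ij: "i < ?n" "j < ?n"
    using circulant_mat_carrier[of v] by (auto simp: cycle_mat_def)
  let ?k = "Suc i mod ?n"
  have k: "?k < ?n" using ij by (intro mod_less_divisor) auto
  have "(cycle_mat ?n * circulant_mat v) $$ (i, j)
      = (\<Sum>l<?n. cycle_mat ?n $$ (i, l) * circulant_mat v $$ (l, j))"
    by (rule index_mult_mat_sum[OF Q circulant_mat_carrier ij])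
  also have "\<dots> = (\<Sum>l<?n. if l = ?k then circulant_mat v $$ (l, j) else 0)"
    using ij by (intro sum.cong) (auto simp: cycle_mat_def)
  also have "\<dots> = (shift ^^ ?k) v ! j"
    using k ij by (simp add: circulant_mat_index)
  also have "\<dots> = (shift ^^ Suc i) v ! j"
    by (simp only: funpow_shift_mod)
  also have "\<dots> = circulant_mat (shift v) $$ (i, j)"
    using ij by (simp add: circulant_mat_index funpow_swap1)
  finally show "circulant_mat (shift v) $$ (i, j) =
      (cycle_mat ?n * circulant_mat v) $$ (i, j)" by simp
qed (use carrier_matD[OF circulant_mat_carrier[of v]]
      carrier_matD[OF circulant_mat_carrier[of "shift v"]] in \<open>simp_all add: cycle_mat_def\<close>)

text \<open>The first standard basis vector. Its circulant matrix is the identity, so the circulant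
  matrices of its shifts are the powers of \<open>cycle_mat n\<close>. At \<open>n = 0\<close> the
  length would be wrong, hence \<open>n \<ge> 1\<close> below.\<close>

definition unit_word :: "nat \<Rightarrow> 'a::field list" where
  "unit_word n = 1 # replicate (n - 1) 0"

lemma length_unit_word: "n \<ge> 1 \<Longrightarrow> length (unit_word n) = n"
  by (simp add: unit_word_def)

lemma circulant_mat_unit_word:
  assumes "n \<ge> 1"
  shows "circulant_mat (unit_word n) = (1\<^sub>m n :: 'a::field mat)"
proof (rule eq_matI)
  let ?e = "unit_word n :: 'a list"
  have len: "length ?e = n" using assms by (rule length_unit_word)
  fix i j assume "i < dim_row (1\<^sub>m n :: 'a mat)" "j < dim_col (1\<^sub>m n :: 'a mat)"
  then have ij: "i < n" "j < n" by auto
  \<comment> \<open>The position that \<open>i\<close> shifts move to \<open>j\<close>, that is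
    \<open>j - i\<close> modulo \<open>n\<close> without leaving the naturals.\<close>
  define k where "k = (j + (n - i)) mod n"
  have k: "k < n" using assms by (simp add: k_def)
  have "(k + i) mod n = (j + (n - i) + i) mod n"
    unfolding k_def by (rule mod_add_left_eq)
  also have "\<dots> = j" using ij by simp
  finally have kj: "(k + i) mod n = j" .
  have "circulant_mat ?e $$ (i, j) = ?e ! k"
    using funpow_shift_nth[of k ?e i] k kj ij len by (simp add: circulant_mat_index)
  also have "\<dots> = (if k = 0 then 1 else 0)"
    using k by (cases k) (auto simp: unit_word_def)
  also have "k = 0 \<longleftrightarrow> i = j"
  proof
    assume "k = 0"
    then show "i = j" using kj ij by simp
  next
    assume "i = j"
    then show "k = 0" using ij by (simp add: k_def)
  qed
  finally show "circulant_mat ?e $$ (i, j) = 1\<^sub>m n $$ (i, j)"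
    using ij by simp
qed (use circulant_mat_carrier[of "unit_word n :: 'a list"] assms in
    \<open>auto simp: length_unit_word\<close>)

text \<open>The left factor is the \<open>i\<close>-th power of the cycle matrix, and each factor of
  it shifts the word once.\<close>

lemma circulant_mat_shifted_unit_word_mult:
  fixes v :: "'a::field list"
  assumes "n \<ge> 1" "length v = n"
  shows "circulant_mat ((shift ^^ i) (unit_word n)) * circulant_mat v
    = circulant_mat ((shift ^^ i) v)"
proof (induction i)
  case 0
  then show ?case
    using assms circulant_mat_carrier[of v] by (simp add: circulant_mat_unit_word)
next
  case (Suc i)
  let ?P = "circulant_mat ((shift ^^ i) (unit_word n)) :: 'a mat"
  have P: "?P \<in> carrier_mat n n" and V: "circulant_mat v \<in> carrier_mat n n"
    and Q: "cycle_mat n \<in> carrier_mat n n"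
    using circulant_mat_carrier[of "(shift ^^ i) (unit_word n)"] circulant_mat_carrier[of v] assms
    by (simp_all add: length_unit_word cycle_mat_def)
  show ?case
    using Suc assms assoc_mult_mat[OF Q P V]
    by (simp add: circulant_mat_shift length_unit_word)
qed

text \<open>A shift multiplies the determinant by that of the cycle matrix, which is a root of
  unity.\<close>

lemma invertible_circulant_mat_funpow_shift:
  fixes v :: "'a::field list"
  assumes "v \<noteq> []"
  shows "invertible_mat (circulant_mat ((shift ^^ i) v)) \<longleftrightarrow> invertible_mat (circulant_mat v)"
proof -
  let ?n = "length v"
  have Q: "cycle_mat ?n \<in> carrier_mat ?n ?n" by (simp add: cycle_mat_def)
  have det_pow: "det (circulant_mat ((shift ^^ k) u)) = det (cycle_mat ?n) ^ k * det (circulant_mat u)"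
    if "length u = ?n" for k and u :: "'a list"
  proof (induction k)
    case (Suc k)
    have "circulant_mat ((shift ^^ k) u) \<in> carrier_mat ?n ?n"
      using circulant_mat_carrier[of "(shift ^^ k) u"] that by simp
    from det_mult[OF Q this] Suc that show ?case
      by (simp add: circulant_mat_shift)
  qed simp
  have n: "?n \<ge> 1" using assms by (simp add: Suc_le_eq)
  \<comment> \<open>After \<open>?n\<close> shifts the unit word returns, and its circulant matrix
    has determinant 1.\<close>
  from det_pow[of "unit_word ?n" ?n] n funpow_shift_length[of "unit_word ?n :: 'a list"]
  have "det (cycle_mat ?n :: 'a mat) ^ ?n = 1"
    by (simp add: length_unit_word circulant_mat_unit_word)
  then have "det (cycle_mat ?n :: 'a mat) \<noteq> 0" using assms by (auto simp: power_0_left)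
  with det_pow[of v i] show ?thesis
    using circulant_mat_carrier[of v] circulant_mat_carrier[of "(shift ^^ i) v"]
    by (simp add: invertible_mat_iff_det_nonzero[of _ ?n])
qed

text \<open>Sorting the rotations preserves their multiset.\<close>

lemma invertible_necklace_iff:
  "invertible_necklace w \<longleftrightarrow> invertible_mat (circulant_mat w)"
proof -
  have "det (bw_mat w) = 0 \<longleftrightarrow> det (circulant_mat w) = 0"
    unfolding bw_mat_def circulant_mat_def
    by (rule det_mat_of_rows_list_mset_cong) (simp_all add: rotations_def)
  then show ?thesis
    by (simp add: invertible_necklace_def invertible_mat_iff_det_nonzero[of _ "length w"])
qed

section \<open>The Reutenauer group\<close>

lemma shifted_unit_word_in_circulant_group:
  assumes "n \<ge> 1"
  shows "circulant_mat ((shift ^^ i) (unit_word n :: 'a::field list)) \<in> carrier (circulant_group n)"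
proof -
  have "unit_word n \<noteq> ([] :: 'a list)" by (simp add: unit_word_def)
  then have "invertible_mat (circulant_mat ((shift ^^ i) (unit_word n :: 'a list)))"
    using assms invertible_mat_iff_det_nonzero[of "1\<^sub>m n :: 'a mat" n]
    by (simp add: invertible_circulant_mat_funpow_shift circulant_mat_unit_word)
  then show ?thesis
    using assms by (force simp: circulant_group_def length_unit_word)
qed

lemma cycle_mat_eq_circulant_mat:
  assumes "n \<ge> 1"
  shows "cycle_mat n = circulant_mat ((shift ^^ 1) (unit_word n :: 'a::field list))"
proof -
  have "(cycle_mat n :: 'a mat) \<in> carrier_mat n n" by (simp add: cycle_mat_def)
  with assms show ?thesis
    by (simp add: circulant_mat_shift length_unit_word circulant_mat_unit_word)
qed

text \<open>The \<open>n\<close>-th power of the cycle matrix is the identity, so inverses are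
  themselves powers with natural exponents.\<close>

lemma generate_cycle_mat:
  assumes n: "n \<ge> 1"
  shows "generate (circulant_group n) {cycle_mat n :: 'a::field mat}
    = range (\<lambda>i. circulant_mat ((shift ^^ i) (unit_word n)))" (is "generate ?G {?Q} = range ?P")
proof -
  have P: "?P i \<in> carrier_mat n n" for i
    using circulant_mat_carrier[of "(shift ^^ i) (unit_word n :: 'a list)"] n
    by (simp add: length_unit_word)
  have PP: "?P i * ?P j = ?P (i + j)" for i j
    using circulant_mat_shifted_unit_word_mult[OF n, of "(shift ^^ j) (unit_word n)"] n
    by (simp add: length_unit_word funpow_add)
  have P0: "?P 0 = 1\<^sub>m n" using n by (simp add: circulant_mat_unit_word)
  have Pn: "?P n = 1\<^sub>m n"
    using n funpow_shift_length[of "unit_word n :: 'a list"]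
    by (simp add: length_unit_word circulant_mat_unit_word)
  have Q: "?Q = ?P 1" by (rule cycle_mat_eq_circulant_mat[OF n])
  \<comment> \<open>The inverse is a definite description over the carrier. Uniqueness follows by
    multiplying \<open>y * ?P 1 = 1\<^sub>m n\<close> from the right by
    \<open>?P (n - 1)\<close>.\<close>
  have inverse: "inv\<^bsub>?G\<^esub> ?Q = ?P (n - 1)"
    unfolding m_inv_def
  proof (rule the_equality)
    show "?P (n - 1) \<in> carrier ?G \<and> ?Q \<otimes>\<^bsub>?G\<^esub> ?P (n - 1) = \<one>\<^bsub>?G\<^esub> \<and>
        ?P (n - 1) \<otimes>\<^bsub>?G\<^esub> ?Q = \<one>\<^bsub>?G\<^esub>"
      using shifted_unit_word_in_circulant_group[OF n, of "n - 1", where ?'a = 'a]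
        PP[of 1 "n - 1"] PP[of "n - 1" 1] Pn n Q
      by (simp add: circulant_group_def)
  next
    fix y assume y: "y \<in> carrier ?G \<and> ?Q \<otimes>\<^bsub>?G\<^esub> y = \<one>\<^bsub>?G\<^esub> \<and> y \<otimes>\<^bsub>?G\<^esub> ?Q = \<one>\<^bsub>?G\<^esub>"
    then have Y: "y \<in> carrier_mat n n" and yQ: "y * ?P 1 = 1\<^sub>m n"
      using Q by (auto simp: circulant_group_def)
    have "y * ?P 1 * ?P (n - 1) = y * (?P 1 * ?P (n - 1))"
      by (rule assoc_mult_mat[OF Y P P])
    also have "\<dots> = y" using PP[of 1 "n - 1"] n Pn Y by simp
    finally show "y = ?P (n - 1)" using yQ P[of "n - 1"] by simp
  qed
  have "M \<in> range ?P" if "M \<in> generate ?G {?Q}" for M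
    using that
  proof induction
    case one
    then show ?case using P0 by (auto simp: circulant_group_def intro: range_eqI[of _ _ 0])
  next
    case (incl h)
    then show ?case using Q by blast
  next
    case (inv h)
    then show ?case using inverse by blast
  next
    case (eng h1 h2)
    then show ?case using PP by (auto simp: circulant_group_def)
  qed
  moreover have "?P i \<in> generate ?G {?Q}" for i
  proof (induction i)
    case 0
    then show ?case using generate.one[of ?G "{?Q}"] P0 by (simp add: circulant_group_def)
  next
    case (Suc i)
    have "?Q \<otimes>\<^bsub>?G\<^esub> ?P i \<in> generate ?G {?Q}"
      by (rule generate.eng[OF generate.incl Suc]) simp
    moreover have "?Q \<otimes>\<^bsub>?G\<^esub> ?P i = ?P (Suc i)"
      using PP[of 1 i] Q by (simp add: circulant_group_def)
    ultimately show ?case by argo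
  qed
  ultimately show ?thesis by blast
qed

text \<open>The coset of \<open>circulant_mat v\<close> consists of its products with powers of the
  cycle matrix, which are the circulant matrices of the rotations of \<open>v\<close>.\<close>

lemma carrier_reutenauer_group:
  assumes n: "n \<ge> 1"
  shows "carrier (reutenauer_group n :: 'a::field mat set monoid) =
    {circulant_mat ` necklace v | v. length v = n \<and> invertible_mat (circulant_mat v)}"
proof -
  have "generate (circulant_group n) {cycle_mat n} #>\<^bsub>circulant_group n\<^esub> circulant_mat v
      = circulant_mat ` necklace v" if "length v = n" for v :: "'a list"
  proof -
    have "v \<noteq> []" using that n by auto
    then have "circulant_mat ` necklace v = range (\<lambda>i. circulant_mat ((shift ^^ i) v))"
      by (auto simp: necklace_eq_range)
    also have "\<dots> = range (\<lambda>i. circulant_mat ((shift ^^ i) (unit_word n)) * circulant_mat v)"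
      by (simp add: circulant_mat_shifted_unit_word_mult[OF n that])
    finally show ?thesis
      unfolding generate_cycle_mat[OF n] r_coset_def by (auto simp: circulant_group_def)
  qed
  then show ?thesis
    unfolding reutenauer_group_def FactGroup_def RCOSETS_def
    by (auto simp: circulant_group_def)
qed

section \<open>Normal elements\<close>

text \<open>Multiplication by a nonzero \<open>x\<close> permutes the nonzero elements; comparing
  their products and cancelling gives \<open>x ^ card ?U = 1\<close>.\<close>

lemma finite_field_power_CARD:
  fixes x :: "'k::{field,finite}"
  shows "x ^ CARD('k) = x"
proof (cases "x = 0")
  case False
  let ?U = "UNIV - {0 :: 'k}"
  have "bij_betw ((*) x) ?U ?U"
    using False by (intro bij_betw_byWitness[of _ "\<lambda>y. y / x"]) auto
  then have "(\<Prod>y\<in>?U. x * y) = \<Prod>?U"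
    by (rule prod.reindex_bij_betw)
  then have "x ^ card ?U = 1"
    by (simp add: prod.distrib del: card_Diff_insert)
  then have "x ^ Suc (card ?U) = x"
    by (simp only: power_Suc mult_1_right)
  then show ?thesis by (simp only: card_Suc_Diff1 finite UNIV_I)
qed simp

text \<open>The characteristic of a finite field is prime and divides the number of its
  elements.\<close>

lemma CHAR_eq_prime_of_CARD:
  assumes "prime p" "CARD('k::{field,finite}) = p ^ n"
  shows "CHAR('k) = p"
proof -
  have "prime CHAR('k)"
    using prime_CHAR_semidom[where ?'a = 'k] finite_imp_CHAR_pos[where ?'a = 'k] by simp
  moreover have "CHAR('k) dvd p ^ n"
    using CHAR_dvd_CARD[where ?'a = 'k] assms by simp
  ultimately show ?thesis
    using assms prime_dvd_power primes_dvd_imp_eq by blast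
qed

section \<open>Coordinates with respect to conjugates in a field with \<open>p ^ n\<close>
  elements\<close>

context
  fixes p n :: nat
  assumes card_alphabet: "CARD('p::prime_card) = p"
    and n_pos: "n \<ge> 1"
    and card_field: "CARD('k::{field,finite}) = p ^ n"
begin

private abbreviation (input) emb :: "'p mod_ring \<Rightarrow> 'k" where "emb \<equiv> gf_embed"

private lemma char_field: "CHAR('k) = p"
  using CHAR_eq_prime_of_CARD[of p n, where ?'k = 'k] card_field card_alphabet
    prime_card[where ?'a = 'p] by simp

text \<open>Arithmetic in \<open>'p mod_ring\<close> reduces integer representatives modulo
  \<open>p\<close>, which is invisible in characteristic \<open>p\<close>; this makes
  \<open>emb\<close> a homomorphism.\<close>

private lemma of_int_mod_p: "(of_int (a mod int p) :: 'k) = of_int a"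
proof -
  have "(of_int a :: 'k) = of_int (int p * (a div int p) + a mod int p)" by simp
  also have "\<dots> = of_nat CHAR('k) * of_int (a div int p) + of_int (a mod int p)"
    by (simp only: of_int_add of_int_mult of_int_of_nat_eq char_field)
  finally show ?thesis by simp
qed

private lemma emb_add: "emb (a + b) = emb a + emb b"
  using of_int_mod_p[of "to_int_mod_ring a + to_int_mod_ring b"] card_alphabet
  by (simp add: gf_embed_def to_int_mod_ring.rep_eq plus_mod_ring.rep_eq)

private lemma emb_mult: "emb (a * b) = emb a * emb b"
  using of_int_mod_p[of "to_int_mod_ring a * to_int_mod_ring b"] card_alphabet
  by (simp add: gf_embed_def to_int_mod_ring.rep_eq times_mod_ring.rep_eq)

private lemma emb_0 [simp]: "emb 0 = 0" and emb_1 [simp]: "emb 1 = 1"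
  by (simp_all add: gf_embed_def)

private lemma emb_sum: "emb (sum f A) = (\<Sum>a\<in>A. emb (f a))"
  by (induction A rule: infinite_finite_induct) (auto simp: emb_add)

private lemma emb_power: "emb a ^ m = emb (a ^ m)"
  by (induction m) (auto simp: emb_mult)

text \<open>Frobenius fixes the prime field, so it will act on the conjugates and leave coefficients
  alone.\<close>

private lemma emb_power_p: "emb a ^ p = emb a"
  using finite_field_power_CARD[of a] card_alphabet by (simp add: emb_power)

private definition comb :: "(nat \<Rightarrow> 'k) \<Rightarrow> (nat \<Rightarrow> 'p mod_ring) \<Rightarrow> 'k" where
  "comb g c = (\<Sum>j<n. emb (c j) * g j)"

private lemma module_gf_scale: "Modules.module (gf_scale :: 'p mod_ring \<Rightarrow> 'k \<Rightarrow> 'k)"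
  by unfold_locales (auto simp: gf_scale_def emb_add emb_mult algebra_simps)

private lemma span_eq_range_comb:
  "module.span (gf_scale :: 'p mod_ring \<Rightarrow> 'k \<Rightarrow> 'k) (g ` {..<n}) = range (comb g)"
proof -
  interpret Modules.module "gf_scale :: 'p mod_ring \<Rightarrow> 'k \<Rightarrow> 'k" by (rule module_gf_scale)
  have "subspace (range (comb g))"
  proof (rule subspaceI)
    show "0 \<in> range (comb g)"
      by (rule range_eqI[of _ _ "\<lambda>_. 0"]) (simp add: comb_def)
  next
    fix x y assume "x \<in> range (comb g)" "y \<in> range (comb g)"
    then obtain c d where "x = comb g c" "y = comb g d" by blast
    then have "x + y = comb g (\<lambda>j. c j + d j)"
      by (simp add: comb_def emb_add distrib_right sum.distrib)
    then show "x + y \<in> range (comb g)" by blast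
  next
    fix a x assume "x \<in> range (comb g)"
    then obtain c where "x = comb g c" by blast
    then have "gf_scale a x = comb g (\<lambda>j. a * c j)"
      by (simp add: comb_def gf_scale_def emb_mult sum_distrib_left mult.assoc)
    then show "gf_scale a x \<in> range (comb g)" by blast
  qed
  moreover have "g i \<in> range (comb g)" if "i < n" for i
  proof (rule range_eqI)
    have "comb g (\<lambda>j. if j = i then 1 else 0) = (\<Sum>j<n. if j = i then g j else 0)"
      unfolding comb_def by (intro sum.cong) auto
    then show "g i = comb g (\<lambda>j. if j = i then 1 else 0)" using that by simp
  qed
  ultimately have "span (g ` {..<n}) \<subseteq> range (comb g)"
    by (intro span_minimal) auto
  moreover have "comb g c \<in> span (g ` {..<n})" for c
    unfolding comb_def gf_scale_def[symmetric]
    by (intro span_sum span_scale span_base) auto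
  ultimately show ?thesis by blast
qed

text \<open>There are as many coefficient vectors as field elements.\<close>
private lemma comb_inj_of_surj:
  assumes "surj (comb g)" "comb g c = comb g d" "j < n"
  shows "c j = d j"
proof -
  \<comment> \<open>Functions on all of \<open>nat\<close> form an infinite type; extensional
    functions on \<open>{..<n}\<close> can be counted and give the same values of
    \<open>comb g\<close>.\<close>
  let ?W = "{..<n} \<rightarrow>\<^sub>E (UNIV :: 'p mod_ring set)"
  have restrict: "comb g (restrict c {..<n}) = comb g c" for c
    by (simp add: comb_def)
  have "comb g ` ?W = UNIV"
  proof (rule UNIV_eq_I[symmetric])
    fix y
    obtain c where "y = comb g c" using assms(1) by (metis surjD)
    then show "y \<in> comb g ` ?W"
      by (intro image_eqI[of _ _ "restrict c {..<n}"]) (auto simp: restrict)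
  qed
  moreover have "card ?W = CARD('k)"
    using card_alphabet card_field by (simp add: card_PiE)
  ultimately have "inj_on (comb g) ?W"
    by (intro eq_card_imp_inj_on) (auto intro: finite_PiE)
  then have "restrict c {..<n} = restrict d {..<n}"
    by (rule inj_onD) (use assms(2) in \<open>auto simp: restrict\<close>)
  then show ?thesis using \<open>j < n\<close> by (metis lessThan_iff restrict_apply')
qed

text \<open>Spanning already forces independence: a surjective \<open>comb\<close> is injective by
  counting.\<close>

private lemma normal_element_iff_surj:
  "normal_element TYPE('p) n \<beta> \<longleftrightarrow> surj (comb (\<lambda>j. \<beta> ^ (p ^ j)))"
proof -
  interpret Modules.module "gf_scale :: 'p mod_ring \<Rightarrow> 'k \<Rightarrow> 'k" by (rule module_gf_scale)
  define g where "g = (\<lambda>j. \<beta> ^ (p ^ j))"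
  have normal: "normal_element TYPE('p) n \<beta> \<longleftrightarrow> \<not> dependent (g ` {..<n}) \<and> surj (comb g)"
    using span_eq_range_comb[of g] card_alphabet
    by (simp add: normal_element_def Let_def g_def)
  have "\<not> dependent (g ` {..<n})" if surj: "surj (comb g)"
  proof
    \<comment> \<open>Dependence speaks about the set of conjugates; to read it as a relation
      between positions the conjugates must be distinct.\<close>
    have inj: "inj_on g {..<n}"
    proof (rule inj_onI, rule ccontr)
      fix i j assume ij: "i \<in> {..<n}" "j \<in> {..<n}" "g i = g j" "i \<noteq> j"
      have single: "comb g (\<lambda>l. if l = k then 1 else 0) = g k" if "k < n" for k
      proof -
        have "comb g (\<lambda>l. if l = k then 1 else 0) = (\<Sum>l<n. if l = k then g l else 0)"
          unfolding comb_def by (intro sum.cong) auto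
        with that show ?thesis by simp
      qed
      have "comb g (\<lambda>l. if l = i then 1 else 0) = comb g (\<lambda>l. if l = j then 1 else 0)"
        using ij by (simp add: single)
      from comb_inj_of_surj[OF surj this, of i] ij show False by simp
    qed
    assume "dependent (g ` {..<n})"
    then obtain u :: "'k \<Rightarrow> 'p mod_ring" and v where v: "v \<in> g ` {..<n}" "u v \<noteq> 0"
      and 0: "(\<Sum>v\<in>g ` {..<n}. gf_scale (u v) v) = 0"
      unfolding dependent_finite[OF finite_imageI[OF finite_lessThan]] by blast
    from 0 inj have "comb g (u \<circ> g) = comb g (\<lambda>_. 0)"
      by (simp add: comb_def sum.reindex gf_scale_def)
    with comb_inj_of_surj[OF surj this] v show False by auto
  qed
  with normal show ?thesis by (auto simp: g_def)
qed

text \<open>Frobenius is additive, fixes the coefficients and sends each conjugate of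
  \<open>\<gamma>\<close> to the next, the last one back to the first since
  \<open>\<gamma> ^ (p ^ n) = \<gamma>\<close>. The coefficients thus move one place
  cyclically.\<close>

private lemma comb_conjugates_power:
  assumes len: "length v = n"
  shows "comb (\<lambda>j. \<gamma> ^ (p ^ j)) ((!) v) ^ p = comb (\<lambda>j. \<gamma> ^ (p ^ j)) ((!) (shift v))"
proof -
  define g where "g = (\<lambda>j. \<gamma> ^ (p ^ j))"
  have g_power: "g j ^ p = g (Suc j)" for j
    by (simp add: g_def power_mult[symmetric] mult.commute)
  have g_n: "g n = g 0"
    using finite_field_power_CARD[of \<gamma>] card_field by (simp add: g_def)
  have "comb g ((!) v) ^ p = (\<Sum>j<n. (emb (v ! j) * g j) ^ p)"
    unfolding comb_def using char_field card_alphabet prime_card[where ?'a = 'p]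
    by (intro freshmans_dream_sum) auto
  also have "\<dots> = (\<Sum>j<n. emb (v ! j) * g (Suc j))"
    by (simp add: power_mult_distrib emb_power_p g_power)
  also have "\<dots> = (\<Sum>j<n. emb (shift v ! (Suc j mod n)) * g (Suc j mod n))"
  proof (rule sum.cong)
    fix j assume "j \<in> {..<n}"
    then have "j < n" by simp
    moreover from this have "g (Suc j mod n) = g (Suc j)"
      using g_n by (cases "Suc j = n") auto
    ultimately show "emb (v ! j) * g (Suc j) = emb (shift v ! (Suc j mod n)) * g (Suc j mod n)"
      using shift_nth[of j v] len by simp
  qed simp
  also have "\<dots> = comb g ((!) (shift v))"
    unfolding comb_def
  \<comment> \<open>Adding \<open>n - 1\<close> modulo \<open>n\<close> undoes the cyclic
    successor.\<close>
  proof (rule sum.reindex_bij_witness[of _ "\<lambda>j. (j + (n - 1)) mod n" "\<lambda>j. Suc j mod n"])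
    fix j assume "j \<in> {..<n}"
    then have j: "j < n" by simp
    show "(Suc j mod n + (n - 1)) mod n = j"
      using j by (cases "Suc j = n") auto
    show "Suc ((j + (n - 1)) mod n) mod n = j"
      using j by (simp add: mod_Suc_eq)
  qed (use n_pos in auto)
  finally show ?thesis by (simp add: g_def)
qed

private lemma comb_conjugates_power_p_power:
  assumes "length v = n"
  shows "comb (\<lambda>j. \<gamma> ^ (p ^ j)) ((!) v) ^ (p ^ i)
    = comb (\<lambda>j. \<gamma> ^ (p ^ j)) ((!) ((shift ^^ i) v))"
proof (induction i)
  case (Suc i)
  have "comb (\<lambda>j. \<gamma> ^ (p ^ j)) ((!) v) ^ (p ^ Suc i)
      = (comb (\<lambda>j. \<gamma> ^ (p ^ j)) ((!) v) ^ (p ^ i)) ^ p"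
    by (simp add: power_mult[symmetric] mult.commute)
  with Suc assms show ?case by (simp add: comb_conjugates_power)
qed simp

text \<open>Because \<open>comb g\<close> is bijective on coordinates, the conjugates of the new
  element span exactly when the rows of the circulant matrix do.\<close>

lemma normal_element_iff_invertible_circulant_mat:
  fixes \<gamma> :: 'k and v :: "'p mod_ring list"
  assumes "normal_element TYPE('p) n \<gamma>" and len: "length v = n"
  shows "normal_element TYPE('p) n (\<Sum>j<n. gf_embed (v ! j) * \<gamma> ^ (p ^ j))
    \<longleftrightarrow> invertible_mat (circulant_mat v)"
proof -
  define g where "g = (\<lambda>j. \<gamma> ^ (p ^ j))"
  let ?A = "circulant_mat v"
  define \<beta> where "\<beta> = comb g ((!) v)"
  define h where "h = (\<lambda>j. \<beta> ^ (p ^ j))"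
  \<comment> \<open>\<open>T\<close> multiplies a coefficient row by \<open>?A\<close>: it turns
    coefficients for the conjugates of \<open>\<beta>\<close> into coordinates for those of
    \<open>\<gamma>\<close>.\<close>
  define T where "T c = (\<lambda>j. \<Sum>i<n. c i * ?A $$ (i, j))" for c
  have A: "?A \<in> carrier_mat n n" using circulant_mat_carrier[of v] len by simp
  have surj_g: "surj (comb g)" using assms(1) by (simp add: normal_element_iff_surj g_def)
  have h: "h i = (\<Sum>j<n. emb (?A $$ (i, j)) * g j)" if "i < n" for i
    using comb_conjugates_power_p_power[OF len, of \<gamma> i] that len
    by (simp add: h_def \<beta>_def g_def comb_def circulant_mat_index)
  have comb_h: "comb h c = comb g (T c)" for c
  proof -
    have "comb h c = (\<Sum>i<n. \<Sum>j<n. emb (c i) * (emb (?A $$ (i, j)) * g j))"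
      unfolding comb_def by (intro sum.cong) (auto simp: h sum_distrib_left)
    also have "\<dots> = (\<Sum>j<n. \<Sum>i<n. emb (c i) * (emb (?A $$ (i, j)) * g j))"
      by (rule sum.swap)
    also have "\<dots> = comb g (T c)"
      by (simp add: comb_def T_def emb_sum emb_mult sum_distrib_right mult.assoc)
    finally show ?thesis .
  qed
  have comb_cong: "comb g c = comb g d" if "\<forall>j<n. c j = d j" for c d
    using that by (simp add: comb_def)
  have "surj (comb h) \<longleftrightarrow> det ?A \<noteq> 0"
  proof
    assume surj_h: "surj (comb h)"
    show "det ?A \<noteq> 0"
    proof (rule row_combinations_imp_det_nonzero[OF A])
      fix x
      obtain c where "comb g x = comb h c" using surj_h by (metis surjD)
      then have "\<forall>j<n. x j = T c j"
        using comb_inj_of_surj[OF surj_g] by (auto simp: comb_h)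
      then show "\<exists>c. \<forall>j<n. x j = (\<Sum>i<n. c i * ?A $$ (i, j))" by (auto simp: T_def)
    qed
  next
    assume det: "det ?A \<noteq> 0"
    have "\<exists>c. y = comb h c" for y
    proof -
      obtain x where x: "y = comb g x" using surj_g by (metis surjD)
      obtain c where "\<forall>j<n. x j = T c j"
        using det_nonzero_imp_row_combination[OF A det, of x] by (auto simp: T_def)
      then have "y = comb h c" using comb_cong x comb_h by metis
      then show ?thesis by blast
    qed
    then show "surj (comb h)" by (simp add: surj_def)
  qed
  then have "normal_element TYPE('p) n \<beta> \<longleftrightarrow> invertible_mat ?A"
    by (simp only: normal_element_iff_surj h_def invertible_mat_iff_det_nonzero[OF A])
  then show ?thesis by (simp only: \<beta>_def g_def comb_def)
qed

end

section \<open>Words as combinations of rotations\<close>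

text \<open>
  If two rotations coincide, the set \<open>necklace w\<close> has fewer elements than the matrix has rows; the
  coefficient of a word is then assigned to its first occurrence among the rows.
\<close>
lemma invertible_circulant_mat_iff_unique_combination:
  fixes w :: "'a::field list"
  assumes "w \<noteq> []" and len: "length w = n"
  shows "invertible_mat (circulant_mat w) \<longleftrightarrow>
    (\<forall>x. length x = n \<longrightarrow>
      (\<exists>!c. c \<in> necklace w \<rightarrow>\<^sub>E UNIV \<and> (\<forall>j<n. x ! j = (\<Sum>v\<in>necklace w. c v * v ! j))))"
    (is "_ \<longleftrightarrow> (\<forall>x. _ \<longrightarrow> (\<exists>!c. ?rep x c))")
proof -
  let ?A = "circulant_mat w"
  let ?r = "\<lambda>i. (shift ^^ i) w"
  have A: "?A \<in> carrier_mat n n" using circulant_mat_carrier[of w] len by simp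
  have necklace: "necklace w = ?r ` {..<n}"
    by (auto simp: necklace_def rotations_def len)
  have entry: "?A $$ (i, j) = ?r i ! j" if "i < n" "j < n" for i j
    using that len by (simp add: circulant_mat_index)
  show ?thesis
  proof
    assume "invertible_mat ?A"
    then have det: "det ?A \<noteq> 0" using invertible_mat_iff_det_nonzero[OF A] by simp
    \<comment> \<open>Coinciding rotations would be equal rows and make the determinant
      vanish.\<close>
    have inj: "inj_on ?r {..<n}"
    proof (rule inj_onI, rule ccontr)
      fix i k assume ik: "i \<in> {..<n}" "k \<in> {..<n}" "?r i = ?r k" "i \<noteq> k"
      then have "row ?A i = row ?A k"
        using A entry by (intro eq_vecI) auto
      with det_identical_rows[OF A] ik det show False by auto
    qed
    have sum_necklace: "(\<Sum>v\<in>necklace w. c v * v ! j) = (\<Sum>i<n. c (?r i) * ?A $$ (i, j))"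
      if "j < n" for c j
      using that inj entry by (simp add: necklace sum.reindex)
    show "\<forall>x. length x = n \<longrightarrow> (\<exists>!c. ?rep x c)"
    proof (intro allI impI)
      fix x :: "'a list"
      obtain d where d: "\<forall>j<n. x ! j = (\<Sum>i<n. d i * ?A $$ (i, j))"
        using det_nonzero_imp_row_combination[OF A det, of "(!) x"] by blast
      \<comment> \<open>The row coefficients carried over to words; restricting fixes the value
        outside the necklace, as uniqueness of a function requires.\<close>
      define c where "c = restrict (d \<circ> the_inv_into {..<n} ?r) (necklace w)"
      have "c (?r i) = d i" if "i < n" for i
        using that the_inv_into_f_f[OF inj] by (simp add: c_def necklace)
      moreover have "c \<in> necklace w \<rightarrow>\<^sub>E UNIV" by (simp add: c_def)
      ultimately have c: "?rep x c"
        using d by (simp add: sum_necklace)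
      show "\<exists>!c. ?rep x c"
      proof (intro ex1I[of _ c] c)
        fix c' assume c': "?rep x c'"
        have "c' (?r i) = c (?r i)" if "i < n" for i
        proof (rule det_nonzero_row_combination_unique[OF A det _ that])
          show "(\<Sum>i<n. c' (?r i) * ?A $$ (i, j)) = (\<Sum>i<n. c (?r i) * ?A $$ (i, j))"
            if "j < n" for j
            using c c' that by (simp flip: sum_necklace)
        qed
        then have "c' v = c v" if "v \<in> necklace w" for v
          using that by (auto simp: necklace)
        then show "c' = c"
          using PiE_ext[OF conjunct1[OF c'] conjunct1[OF c]] by simp
      qed
    qed
  next
    assume rep: "\<forall>x. length x = n \<longrightarrow> (\<exists>!c. ?rep x c)"
    have "det ?A \<noteq> 0"
    proof (rule row_combinations_imp_det_nonzero[OF A])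
      fix x
      \<comment> \<open>The vector \<open>x\<close> is a function on \<open>nat\<close> here and is
        tabulated into a word of length \<open>n\<close>.\<close>
      have "\<exists>!c. ?rep (map x [0..<n]) c" by (rule rep[rule_format]) simp
      from ex1_implies_ex[OF this] obtain c where c: "?rep (map x [0..<n]) c" ..
      let ?f = "inv_into {..<n} ?r"
      define d where "d i = (if i \<in> ?f ` necklace w then c (?r i) else 0)" for i
      have sub: "?f ` necklace w \<subseteq> {..<n}"
        unfolding necklace by (intro image_subsetI inv_into_into)
      have recover: "?r (?f v) = v" if "v \<in> necklace w" for v
        using that unfolding necklace by (rule f_inv_into_f)
      have inj: "inj_on ?f (necklace w)" unfolding necklace by (rule inj_on_inv_into) simp
      have "(\<Sum>v\<in>necklace w. c v * v ! j) = (\<Sum>i<n. d i * ?A $$ (i, j))" if "j < n" for j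
      proof -
        have "(\<Sum>i<n. d i * ?A $$ (i, j)) = (\<Sum>i\<in>?f ` necklace w. d i * ?A $$ (i, j))"
          using sub by (intro sum.mono_neutral_right) (auto simp: d_def)
        also have "\<dots> = (\<Sum>i\<in>?f ` necklace w. c (?r i) * ?r i ! j)"
          using sub entry that by (intro sum.cong) (auto simp: d_def)
        also have "\<dots> = (\<Sum>v\<in>necklace w. c v * v ! j)"
          unfolding sum.reindex[OF inj] o_def
          by (intro sum.cong) (simp_all add: recover)
        finally show ?thesis by simp
      qed
      with c show "\<exists>d. \<forall>j<n. x j = (\<Sum>i<n. d i * ?A $$ (i, j))"
        by (intro exI[of _ d]) simp
    qed
    then show "invertible_mat ?A" using invertible_mat_iff_det_nonzero[OF A] by simp
  qed
qed

section \<open>Equivalence of the five conditions\<close>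

theorem theorem16:
  fixes p n :: nat
    and w :: "'p::prime_card mod_ring list"
    and \<gamma> :: "'k::{field,finite}"
  assumes "CARD('p) = p" and "n \<ge> 1" and "length w = n"
  shows
    "(invertible_necklace w \<longleftrightarrow>
        (\<forall>v\<in>necklace w. invertible_mat (circulant_mat v))) \<and>
     (invertible_necklace w \<longleftrightarrow>
        circulant_mat ` necklace w \<in> carrier (reutenauer_group n)) \<and>
     (CARD('k) = p ^ n \<and> normal_element TYPE('p) n \<gamma> \<longrightarrow>
       (invertible_necklace w \<longleftrightarrow>
          (\<forall>v\<in>necklace w. normal_element TYPE('p) n (\<Sum>j<n. gf_embed (v ! j) * \<gamma> ^ (p ^ j))))) \<and>
     (invertible_necklace w \<longleftrightarrow>
        (\<forall>x::'p mod_ring list. length x = n \<longrightarrow>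
          (\<exists>!c. c \<in> necklace w \<rightarrow>\<^sub>E (UNIV :: 'p mod_ring set) \<and>
                (\<forall>j<n. x ! j = (\<Sum>v\<in>necklace w. c v * v ! j)))))"
proof -
  have w: "w \<noteq> []" using assms by auto
  have length_rotation: "length v = n" if "v \<in> necklace w" for v
    using that assms by (auto simp: necklace_eq_range[OF w])
  have rotation_iff: "invertible_mat (circulant_mat v) \<longleftrightarrow> invertible_necklace w"
    if "v \<in> necklace w" for v
    using that by (auto simp: necklace_eq_range[OF w] invertible_circulant_mat_funpow_shift[OF w]
        invertible_necklace_iff)
  \<comment> \<open>This keeps the quantifiers over the necklace from being vacuous.\<close>
  have self: "v \<in> necklace v" if "v \<noteq> []" for v :: "'p mod_ring list"
    using that by (auto simp: necklace_eq_range intro: range_eqI[of _ _ 0])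
  have "invertible_necklace w \<longleftrightarrow> (\<forall>v\<in>necklace w. invertible_mat (circulant_mat v))"
    using rotation_iff self[OF w] by auto
  moreover have "invertible_necklace w \<longleftrightarrow>
      circulant_mat ` necklace w \<in> carrier (reutenauer_group n)"
  proof
    assume "invertible_necklace w"
    then show "circulant_mat ` necklace w \<in> carrier (reutenauer_group n)"
      using assms by (auto simp: carrier_reutenauer_group invertible_necklace_iff)
  next
    assume "circulant_mat ` necklace w \<in> carrier (reutenauer_group n)"
    then obtain v where v: "length v = n" "invertible_mat (circulant_mat v)"
      and eq: "circulant_mat ` necklace w = circulant_mat ` necklace v"
      using assms by (auto simp: carrier_reutenauer_group)
    \<comment> \<open>Only the sets of matrices are known to agree; the invertible matrix of
      \<open>v\<close> is therefore the matrix of some rotation of \<open>w\<close>.\<close>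
    have "circulant_mat v \<in> circulant_mat ` necklace w"
      unfolding eq using v assms by (intro imageI self) auto
    then show "invertible_necklace w" using v rotation_iff by auto
  qed
  moreover have "invertible_necklace w \<longleftrightarrow>
      (\<forall>v\<in>necklace w. normal_element TYPE('p) n (\<Sum>j<n. gf_embed (v ! j) * \<gamma> ^ (p ^ j)))"
    if "CARD('k) = p ^ n \<and> normal_element TYPE('p) n \<gamma>"
  proof -
    have "normal_element TYPE('p) n (\<Sum>j<n. gf_embed (v ! j) * \<gamma> ^ (p ^ j))
        \<longleftrightarrow> invertible_necklace w" if v: "v \<in> necklace w" for v
      unfolding rotation_iff[OF v, symmetric]
      using \<open>CARD('k) = p ^ n \<and> normal_element TYPE('p) n \<gamma>\<close> length_rotation[OF v]
      by (intro normal_element_iff_invertible_circulant_mat[OF assms(1,2)]) simp_all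
    with self[OF w] show ?thesis by auto
  qed
  moreover note invertible_circulant_mat_iff_unique_combination[OF w assms(3),
      folded invertible_necklace_iff]
  ultimately show ?thesis by (intro conjI impI)
qed

end
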